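(* Let $n\ge 1$, let $M$ be a completely positive $n\times n$ matrix and let $A$ be a copositive $n\times n$ matrix with $\langle M,A\rangle=0$. Let $M=\sum_{j=1}^p \mathbf{x}_j\mathbf{x}_j^\top$, with $\mathbf{x}_1,\dots,\mathbf{x}_p\in\mathbb{R}^n_+$, be any cp decomposition of $M$. Then: (a) for every $1\le i\le n$, the $i$-th column of $M$ is orthogonal (in the standard inner product of $\mathbb{R}^n$) to the $i$-th column of $A$; (b) for every $1\le i\le n$, if $i\in\sigma(\mathbf{x}_j)$ for every $1\le j\le p$, then the $i$-th column of $A$ is in the nullspace of $M$.
   Context: A real symmetric $n\times n$ matrix $A$ is copositive if $\mathbf{x}^\top A\mathbf{x}\ge 0$ for every $\mathbf{x}\in\mathbb{R}^n_+$ (entrywise nonnegative vectors). An $n\times n$ matrix $M$ is completely positive if $M=VV^\top$ for some entrywise nonnegative, not necessarily square, matrix $V$; writing $V=[\mathbf{v}_1,\dots,\mathbf{v}_p]$, this is equivalent to $M=\sum_{i=1}^p\mathbf{v}_i\mathbf{v}_i^\top$ with $\mathbf{v}_i\in\mathbb{R}^n_+$, which is called a cp decomposition of $M$. The scalar product of matrices is $\langle U,V\rangle=\mathrm{trace}(U^\top V)$. For $\mathbf{x}\in\mathbb{R}^n_+$ the support is $\sigma(\mathbf{x})=\{i: x_i>0\}$. *)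

theory Defs
  imports "HOL-Analysis.Analysis"
begin

text \<open>An \<open>n\<close>-by-\<open>n\<close> real matrix is a \<^typ>\<open>real^'n^'n\<close> with \<open>n = CARD('n)\<close>, so \<open>n \<ge> 1\<close> holds
  automatically.\<close>

definition nonneg_orthant :: "(real^'n) set" where
  "nonneg_orthant = {x. \<forall>i. 0 \<le> x $ i}"

definition copositive :: "real^'n^'n \<Rightarrow> bool" where
  "copositive A \<longleftrightarrow> transpose A = A \<and> (\<forall>x\<in>nonneg_orthant. 0 \<le> x \<bullet> (A *v x))"

text \<open>The number \<open>p\<close> of columns of the factor is existentially quantified and so cannot be a type;
  the factor is given by its entries \<open>V i j\<close>, with column index \<open>j \<in> {1..p}\<close>, and the equation is
  \<open>M = V V\<^sup>T\<close> written out.\<close>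

definition completely_positive :: "real^'n^'n \<Rightarrow> bool" where
  "completely_positive M \<longleftrightarrow>
    (\<exists>(p::nat) (V :: 'n \<Rightarrow> nat \<Rightarrow> real).
      (\<forall>i. \<forall>j\<in>{1..p}. 0 \<le> V i j) \<and>
      M = (\<chi> i k. \<Sum>j=1..p. V i j * V k j))"

text \<open>Only the values \<open>x 1, \<dots>, x p\<close> matter. The library's \<^const>\<open>columnvector\<close> and
  \<^const>\<open>rowvector\<close> leave the number of copies of the vector polymorphic; the type constraints
  fix it to one, so that each summand is \<open>x\<^sub>j x\<^sub>j\<^sup>T\<close>.\<close>

definition cp_decomposition :: "real^'n^'n \<Rightarrow> nat \<Rightarrow> (nat \<Rightarrow> real^'n) \<Rightarrow> bool" where
  "cp_decomposition M p x \<longleftrightarrow>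
    (\<forall>j\<in>{1..p}. x j \<in> nonneg_orthant) \<and>
    M = (\<Sum>j=1..p. (columnvector (x j) :: real^1^'n) ** (rowvector (x j) :: real^'n^1))"

definition mat_inner :: "real^'n^'m \<Rightarrow> real^'n^'m \<Rightarrow> real" where
  "mat_inner U V = trace (transpose U ** V)"

definition vec_support :: "real^'n \<Rightarrow> 'n set" where
  "vec_support x = {i. 0 < x $ i}"

definition mat_nullspace :: "real^'n^'m \<Rightarrow> (real^'n) set" where
  "mat_nullspace M = {v. M *v v = 0}"

end

theory Submission
  imports Defs
begin

text \<open>The inner product of \<open>M\<close> and \<open>A\<close> is the sum of the numbers \<open>x\<^sub>j\<^sup>T A x\<^sub>j \<ge> 0\<close>, so each \<open>x\<^sub>j\<close> is a zero, hence
  a minimiser over the nonnegative orthant, of the quadratic form of \<open>A\<close>. The first-order optimality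
  conditions at \<open>x\<^sub>j\<close> are \<open>A x\<^sub>j \<ge> 0\<close> and complementary slackness \<open>(x\<^sub>j)\<^sub>i (A x\<^sub>j)\<^sub>i = 0\<close>; both claims
  follow by summing over \<open>j\<close>.\<close>

lemma cp_decomposition_nth:
  assumes "cp_decomposition M p x"
  shows "M $ a $ b = (\<Sum>j=1..p. x j $ a * x j $ b)"
  using assms
  by (simp add: cp_decomposition_def matrix_matrix_mult_def columnvector_def rowvector_def)

text \<open>Since \<open>M\<close> acts as a combination of the \<open>x j\<close>, a vector
  orthogonal to every \<open>x j\<close> lies in its nullspace.\<close>

lemma cp_decomposition_mult_vec:
  assumes "cp_decomposition M p x"
  shows "M *v v = (\<Sum>j=1..p. (x j \<bullet> v) *\<^sub>R x j)"
proof -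
  have "(M *v v) $ a = (\<Sum>j=1..p. (x j \<bullet> v) *\<^sub>R x j) $ a" for a
  proof -
    have "(M *v v) $ a = (\<Sum>b\<in>UNIV. \<Sum>j=1..p. x j $ a * x j $ b * v $ b)"
      by (simp add: matrix_vector_mult_def cp_decomposition_nth[OF assms] sum_distrib_right)
    also have "\<dots> = (\<Sum>j=1..p. \<Sum>b\<in>UNIV. x j $ a * x j $ b * v $ b)"
      by (rule sum.swap)
    finally show ?thesis
      by (simp add: inner_vec_def sum_distrib_left sum_distrib_right mult_ac)
  qed
  then show ?thesis
    by (simp add: vec_eq_iff)
qed

lemma inner_column_symmetric:
  fixes A :: "real^'n^'n"
  assumes "transpose A = A"
  shows "y \<bullet> column i A = (A *v y) $ i"
proof -
  have "A $ k $ i = A $ i $ k" for k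
    by (metis assms transpose_def vec_lambda_beta)
  then show ?thesis
    by (simp add: inner_vec_def matrix_vector_mult_def column_def mult.commute)
qed

text \<open>Column \<open>i\<close> of \<open>M\<close> is the combination of the \<open>x j\<close>
  with weights \<open>x j $ i\<close>, so the inner product splits into exactly the products that
  complementary slackness makes vanish.\<close>

lemma inner_column_cp_decomposition:
  fixes A :: "real^'n^'n"
  assumes "cp_decomposition M p x" and "transpose A = A"
  shows "column i M \<bullet> column i A = (\<Sum>j=1..p. x j $ i * (A *v x j) $ i)"
proof -
  have "column i M = M *v axis i 1"
    by (simp add: matrix_vector_mult_basis)
  also have "\<dots> = (\<Sum>j=1..p. (x j $ i) *\<^sub>R x j)"
    by (simp add: cp_decomposition_mult_vec[OF assms(1)] inner_axis)
  finally have "column i M \<bullet> column i A = (\<Sum>j=1..p. x j $ i * (x j \<bullet> column i A))"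
    by (simp add: inner_sum_left)
  then show ?thesis
    by (simp only: inner_column_symmetric[OF assms(2)])
qed

lemma mat_inner_eq_sum_column: "mat_inner U V = (\<Sum>i\<in>UNIV. column i U \<bullet> column i V)"
  by (simp add: mat_inner_def trace_def matrix_matrix_mult_def transpose_def column_def inner_vec_def)

lemma mat_inner_cp_decomposition:
  fixes A :: "real^'n^'n"
  assumes "cp_decomposition M p x" and "transpose A = A"
  shows "mat_inner M A = (\<Sum>j=1..p. x j \<bullet> (A *v x j))"
  unfolding mat_inner_eq_sum_column inner_column_cp_decomposition[OF assms]
  by (subst sum.swap) (simp add: inner_vec_def)

text \<open>Increasing coordinate \<open>i\<close> of \<open>x\<close> stays in the orthant, where
  the form cannot drop below its value 0 at \<open>x\<close>. A negative
  \<open>(A *v x) $ i\<close>, half the derivative in that direction, would make it drop.\<close>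

lemma copositive_zero_gradient_nonneg:
  fixes A :: "real^'n^'n"
  assumes cop: "copositive A" and x: "x \<in> nonneg_orthant" and zero: "x \<bullet> (A *v x) = 0"
  shows "0 \<le> (A *v x) $ i"
proof (rule ccontr)
  assume neg: "\<not> 0 \<le> (A *v x) $ i"
  define g where "g = (A *v x) $ i"
  define a where "a = A $ i $ i"
  have sym: "transpose A = A"
    using cop by (simp add: copositive_def)
  have ineq: "0 \<le> t * (2 * g + t * a)" if "0 \<le> t" for t
  proof -
    define y where "y = x + t *\<^sub>R axis i 1"
    have "y \<in> nonneg_orthant"
      using x that by (auto simp: y_def nonneg_orthant_def axis_def)
    then have "0 \<le> y \<bullet> (A *v y)"
      using cop by (simp add: copositive_def)
    also have "A *v y = A *v x + t *\<^sub>R column i A"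
      by (simp add: y_def matrix_vector_right_distrib matrix_vector_mult_scaleR
          matrix_vector_mult_basis)
    also have "y \<bullet> \<dots> = t * (2 * g + t * a)"
      using zero inner_column_symmetric[OF sym, of x i]
      by (simp add: y_def g_def a_def inner_add_left inner_add_right inner_axis' column_def
          algebra_simps)
    finally show ?thesis .
  qed
  \<comment> \<open>With this step \<open>t * (1 + \<bar>a\<bar>) = - g\<close>, so the second-order
    term \<open>t * a\<close> is at most \<open>- g\<close> and
    \<open>2 * g + t * a \<le> g < 0\<close>.\<close>
  define t where "t = - g / (1 + \<bar>a\<bar>)"
  have "0 < t"
    using neg by (simp add: t_def g_def field_simps)
  moreover have "t * a \<le> t * (1 + \<bar>a\<bar>)"
    using \<open>0 < t\<close> by (intro mult_left_mono) auto
  then have "2 * g + t * a < 0"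
    using neg by (simp add: t_def g_def)
  ultimately show False
    using ineq[of t] mult_pos_neg[of t "2 * g + t * a"] by simp
qed

text \<open>The products \<open>x $ k * (A *v x) $ k\<close> are nonnegative and sum to
  \<open>x \<bullet> (A *v x) = 0\<close>.\<close>

lemma copositive_zero_complementary:
  fixes A :: "real^'n^'n"
  assumes "copositive A" and x: "x \<in> nonneg_orthant" and zero: "x \<bullet> (A *v x) = 0"
  shows "x $ i * (A *v x) $ i = 0"
proof -
  have "\<forall>k. 0 \<le> x $ k * (A *v x) $ k"
    using copositive_zero_gradient_nonneg[OF assms] x by (simp add: nonneg_orthant_def)
  then show ?thesis
    using zero by (simp add: inner_vec_def sum_nonneg_eq_0_iff del: mult_eq_0_iff)
qed

theorem theorem2p1:
  fixes M A :: "real^'n^'n" and p :: nat and x :: "nat \<Rightarrow> real^'n"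
  assumes "completely_positive M"
    and "copositive A"
    and "mat_inner M A = 0"
    and "cp_decomposition M p x"
  shows "(\<forall>i. orthogonal (column i M) (column i A)) \<and>
    (\<forall>i. (\<forall>j\<in>{1..p}. i \<in> vec_support (x j)) \<longrightarrow> column i A \<in> mat_nullspace M)"
proof -
  have sym: "transpose A = A"
    using assms(2) by (simp add: copositive_def)
  have x: "x j \<in> nonneg_orthant" if "j \<in> {1..p}" for j
    using assms(4) that by (simp add: cp_decomposition_def)
  have "(\<Sum>j=1..p. x j \<bullet> (A *v x j)) = 0"
    using mat_inner_cp_decomposition[OF assms(4) sym] assms(3) by simp
  moreover have "0 \<le> x j \<bullet> (A *v x j)" if "j \<in> {1..p}" for j
    using assms(2) x[OF that] by (simp add: copositive_def)
  ultimately have zero: "x j \<bullet> (A *v x j) = 0" if "j \<in> {1..p}" for j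
    using that sum_nonneg_eq_0_iff[of "{1..p}" "\<lambda>j. x j \<bullet> (A *v x j)"] by auto
  have compl: "x j $ i * (A *v x j) $ i = 0" if "j \<in> {1..p}" for i j
    using copositive_zero_complementary[OF assms(2) x[OF that] zero[OF that]] .
  show ?thesis
  proof (intro conjI allI impI)
    fix i
    show "orthogonal (column i M) (column i A)"
      unfolding orthogonal_def inner_column_cp_decomposition[OF assms(4) sym]
      using compl by (intro sum.neutral) blast
  next
    fix i
    assume supp: "\<forall>j\<in>{1..p}. i \<in> vec_support (x j)"
    \<comment> \<open>As \<open>x j $ i > 0\<close>, complementary slackness forces
      \<open>(A *v x j) $ i = 0\<close>, which by symmetry of \<open>A\<close> is this inner
      product.\<close>
    have "x j \<bullet> column i A = 0" if "j \<in> {1..p}" for j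
      using compl[OF that, of i] supp that
      by (fastforce simp: inner_column_symmetric[OF sym] vec_support_def)
    then show "column i A \<in> mat_nullspace M"
      by (simp add: mat_nullspace_def cp_decomposition_mult_vec[OF assms(4)])
  qed
qed

end
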